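(* Let $S=(L,A,<)$ be an addable abstract numeration system and let $\mathbf{x}$ be an $S$-automatic infinite word. Then the boundary sequence $\partial_{\mathbf{x}}$ is $S$-automatic.
   Context: Infinite words are indexed from $0$. For an infinite word $\mathbf{x}$ over a finite alphabet $B$, the boundary sequence $\partial_{\mathbf{x}}=(\partial_{\mathbf{x}}[n])_{n\ge 1}$ is defined by $\partial_{\mathbf{x}}[n]=\{(u,v)\in B\times B \mid uyv \text{ is a factor of } \mathbf{x} \text{ for some } y\in B^{n-1}\}$, i.e. $\partial_{\mathbf{x}}[n]=\{(\mathbf{x}[i],\mathbf{x}[i+n])\mid i\ge 0\}$; it is a sequence over the finite alphabet $2^{B\times B}$. An abstract numeration system (ANS) is a triple $S=(L,A,<)$ where $L$ is an infinite regular language over a finite alphabet $A$ totally ordered by $<$. Order $L$ genealogically (first by length, then lexicographically); $\mathrm{rep}_S(n)$ is the $(n+1)$st word of $L$ ($n\ge 0$), and $\mathrm{val}_S\colon L\to\mathbb{N}$ is the inverse of the bijection $\mathrm{rep}_S\colon\mathbb{N}\to L$. Let $\#\notin A$ be a padding symbol, $A_\#=A\cup\{\#\}$, and extend $\mathrm{val}_S$ to $\#^*L$ by $\mathrm{val}_S(\#^n w)=\mathrm{val}_S(w)$ for $w\in L$, $n\ge 0$. The system $S$ is addable if the graph of addition $\mathcal{L}_+$ is a regular language, where $\mathcal{L}_+\subseteq (A_\#\times A_\#\times A_\#)^*$ is the set of triples $(u,v,w)$ of words of equal length, read as words over $A_\#\times A_\#\times A_\#$, such that $u,v,w\in \#^*L$,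 $\mathrm{val}_S(u)+\mathrm{val}_S(v)=\mathrm{val}_S(w)$, and the first letter of the triple is not $(\#,\#,\#)$. A deterministic finite automaton with output (DFAO) is a DFA together with an output map $\tau$ from its state set to a finite alphabet; its output $\mathcal{A}(w)$ on a word $w$ is $\tau(q)$ where $q$ is the state reached by reading $w$ from the initial state. A sequence $\mathbf{y}$ is $S$-automatic if there is a DFAO $\mathcal{A}$ with $\mathbf{y}[n]=\mathcal{A}(\mathrm{rep}_S(n))$ for all indices $n$ for which $\mathbf{y}[n]$ is defined (for a boundary sequence: all $n\ge 1$). *)

theory Defs
  imports Main
begin

section \<open>Finite automata and regular languages\<close>

record ('q, 'a) automaton =
  states :: "'q set"
  initial :: 'q
  trans_fun :: "'q \<Rightarrow> 'a \<Rightarrow> 'q"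

record ('q, 'a) dfa = "('q, 'a) automaton" +
  finals :: "'q set"

record ('q, 'a, 'o) dfao = "('q, 'a) automaton" +
  output_map :: "'q \<Rightarrow> 'o"

definition deterministic_automaton :: "'a set \<Rightarrow> ('q, 'a, 'm) automaton_scheme \<Rightarrow> bool" where
  "deterministic_automaton A M \<longleftrightarrow> finite A \<and> finite (states M) \<and> initial M \<in> states M \<and>
     (\<forall>q \<in> states M. \<forall>a \<in> A. trans_fun M q a \<in> states M)"

definition reached :: "('q, 'a, 'm) automaton_scheme \<Rightarrow> 'a list \<Rightarrow> 'q" where
  "reached M w = foldl (trans_fun M) (initial M) w"

definition is_dfa :: "'a set \<Rightarrow> ('q, 'a) dfa \<Rightarrow> bool" where
  "is_dfa A M \<longleftrightarrow> deterministic_automaton A M \<and> finals M \<subseteq> states M"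

definition is_dfao :: "'a set \<Rightarrow> 'o set \<Rightarrow> ('q, 'a, 'o) dfao \<Rightarrow> bool" where
  "is_dfao A \<Delta> M \<longleftrightarrow> deterministic_automaton A M \<and> finite \<Delta> \<and> output_map M ` states M \<subseteq> \<Delta>"

definition dfa_language :: "'a set \<Rightarrow> ('q, 'a) dfa \<Rightarrow> 'a list set" where
  "dfa_language A M = {w \<in> lists A. reached M w \<in> finals M}"

definition dfao_output :: "('q, 'a, 'o) dfao \<Rightarrow> 'a list \<Rightarrow> 'o" where
  "dfao_output M w = output_map M (reached M w)"

text \<open>A finite state set can always be renamed to a set of natural numbers, so
  quantifying over automata with states of type \<^typ>\<open>nat\<close> is no restriction.\<close>

definition regular_language :: "'a set \<Rightarrow> 'a list set \<Rightarrow> bool" where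
  "regular_language A L \<longleftrightarrow> (\<exists>M :: (nat, 'a) dfa. is_dfa A M \<and> L = dfa_language A M)"


section \<open>Abstract numeration systems\<close>

text \<open>The order is given as a strict relation \<open>r\<close> on the alphabet; the
  genealogical order on words is then \<^term>\<open>lenlex r\<close>.\<close>

definition abstract_numeration_system :: "'a list set \<Rightarrow> 'a set \<Rightarrow> 'a rel \<Rightarrow> bool" where
  "abstract_numeration_system L A r \<longleftrightarrow>
     finite A \<and> r \<subseteq> A \<times> A \<and> strict_linear_order_on A r \<and> regular_language A L \<and> infinite L"

text \<open>The \<open>(n + 1)\<close>st word of \<open>L\<close> is the one with exactly \<open>n\<close> predecessors in \<open>L\<close>.\<close>

definition rep :: "'a list set \<Rightarrow> 'a rel \<Rightarrow> nat \<Rightarrow> 'a list" where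
  "rep L r n = (THE w. w \<in> L \<and> card {v \<in> L. (v, w) \<in> lenlex r} = n)"

definition val :: "'a list set \<Rightarrow> 'a rel \<Rightarrow> 'a list \<Rightarrow> nat" where
  "val L r = the_inv (rep L r)"


section \<open>Addable systems\<close>

text \<open>The padding symbol \<open>#\<close> is \<^term>\<open>None\<close>; a letter \<open>a\<close> of \<open>A\<close> becomes \<^term>\<open>Some a\<close>.\<close>

definition padded_alphabet :: "'a set \<Rightarrow> 'a option set" where
  "padded_alphabet A = insert None (Some ` A)"

definition padded_language :: "'a list set \<Rightarrow> 'a option list set" where
  "padded_language L = {replicate n None @ map Some w | n w. w \<in> L}"

definition padded_val :: "'a list set \<Rightarrow> 'a rel \<Rightarrow> 'a option list \<Rightarrow> nat" where
  "padded_val L r u = val L r (map the (dropWhile (\<lambda>a. a = None) u))"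

definition addition_graph ::
    "'a list set \<Rightarrow> 'a rel \<Rightarrow> ('a option \<times> 'a option \<times> 'a option) list set" where
  "addition_graph L r = {zip u (zip v w) | u v w.
     length u = length v \<and> length v = length w \<and>
     u \<in> padded_language L \<and> v \<in> padded_language L \<and> w \<in> padded_language L \<and>
     padded_val L r u + padded_val L r v = padded_val L r w \<and>
     (u \<noteq> [] \<longrightarrow> (hd u, hd v, hd w) \<noteq> (None, None, None))}"

definition addable :: "'a list set \<Rightarrow> 'a set \<Rightarrow> 'a rel \<Rightarrow> bool" where
  "addable L A r \<longleftrightarrow>
     regular_language (padded_alphabet A \<times> padded_alphabet A \<times> padded_alphabet A)
       (addition_graph L r)"


section \<open>Automatic sequences and boundary sequences\<close>

text \<open>A sequence is a function on \<^typ>\<open>nat\<close> of which only the values at indices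
  in \<open>I\<close> are meaningful.\<close>

definition automatic_on :: "nat set \<Rightarrow> 'a list set \<Rightarrow> 'a set \<Rightarrow> 'a rel \<Rightarrow> (nat \<Rightarrow> 'o) \<Rightarrow> bool" where
  "automatic_on I L A r y \<longleftrightarrow>
     (\<exists>(M :: (nat, 'a, 'o) dfao) \<Delta>. is_dfao A \<Delta> M \<and> (\<forall>n \<in> I. y n = dfao_output M (rep L r n)))"

definition factor :: "'b list \<Rightarrow> (nat \<Rightarrow> 'b) \<Rightarrow> bool" where
  "factor w x \<longleftrightarrow> (\<exists>i. w = map x [i..<i + length w])"

text \<open>Only meaningful for \<open>n \<ge> 1\<close>.\<close>

definition boundary :: "'b set \<Rightarrow> (nat \<Rightarrow> 'b) \<Rightarrow> nat \<Rightarrow> ('b \<times> 'b) set" where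
  "boundary B x n =
     {(u, v) \<in> B \<times> B. \<exists>y \<in> lists B. length y = n - 1 \<and> factor ([u] @ y @ [v]) x}"


section \<open>Basic facts\<close>

lemma total_on_lenlex:
  assumes "total_on A r"
  shows "total_on (lists A) (lenlex r)"
proof -
  have "v \<noteq> w \<longrightarrow> (v, w) \<in> lenlex r \<or> (w, v) \<in> lenlex r"
    if "length v = length w" "v \<in> lists A" "w \<in> lists A" for v w
    using that
  proof (induction v w rule: list_induct2)
    case (Cons a v b w)
    then show ?case
      using assms by (auto simp: Cons_lenlex_iff total_on_def)
  qed simp
  moreover have "(v, w) \<in> lenlex r" if "length v < length w" for v w
    using that by (simp add: lenlex_conv)
  ultimately show ?thesis
    by (meson linorder_neqE_nat total_onI)
qed

lemma boundary_eq:
  assumes "range x \<subseteq> B" "n \<ge> 1"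
  shows "boundary B x n = {(x i, x (i + n)) | i. True}"
proof -
  have fac: "factor ([u] @ y @ [v]) x \<longleftrightarrow>
      (\<exists>i. u = x i \<and> y = map x [Suc i..<i + n] \<and> v = x (i + n))"
    if "length y = n - 1" for u v y
  proof -
    have "[i..<i + length ([u] @ y @ [v])] = [i] @ [Suc i..<i + n] @ [i + n]" for i
      using that assms(2) by (simp add: upt_conv_Cons)
    then show ?thesis
      unfolding factor_def by (simp only: list.map map_append append_Cons append_Nil
          list.inject append1_eq_conv)
  qed
  have mem: "(x i, x (i + n)) \<in> boundary B x n" for i
  proof -
    have "length (map x [Suc i..<i + n]) = n - 1"
      using assms(2) by simp
    moreover have "factor ([x i] @ map x [Suc i..<i + n] @ [x (i + n)]) x"
      using fac[OF calculation] by blast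
    moreover have "map x [Suc i..<i + n] \<in> lists B" "x i \<in> B" "x (i + n) \<in> B"
      using assms(1) by (auto simp: subset_iff)
    ultimately show ?thesis
      unfolding boundary_def by blast
  qed
  have "\<exists>i. p = (x i, x (i + n))" if "p \<in> boundary B x n" for p
    using that fac unfolding boundary_def by blast
  with mem show ?thesis
    by blast
qed

locale ans_words =
  fixes L :: "'a list set" and A :: "'a set" and r :: "'a rel"
  assumes ans: "abstract_numeration_system L A r"
begin

lemma words: "L \<subseteq> lists A"
  using ans by (auto simp: abstract_numeration_system_def regular_language_def dfa_language_def)

lemma genealogical_trans: "trans (lenlex r)"
  using ans
  by (auto simp: abstract_numeration_system_def strict_linear_order_on_def intro: lenlex_transI)

lemma genealogical_irrefl: "(w, w) \<notin> lenlex r"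
proof (rule lenlex_irreflexive)
  show "(a, a) \<notin> r" for a
    using ans
    by (simp add: abstract_numeration_system_def strict_linear_order_on_def irrefl_def)
qed

lemma genealogical_total: "v \<in> L \<Longrightarrow> w \<in> L \<Longrightarrow> v \<noteq> w \<Longrightarrow> (v, w) \<in> lenlex r \<or> (w, v) \<in> lenlex r"
proof -
  assume vw: "v \<in> L" "w \<in> L" "v \<noteq> w"
  have "total_on A r"
    using ans by (simp add: abstract_numeration_system_def strict_linear_order_on_def)
  then have "total_on (lists A) (lenlex r)"
    by (rule total_on_lenlex)
  then show ?thesis
    using vw words unfolding total_on_def by blast
qed

definition preds :: "'a list \<Rightarrow> 'a list set" where
  "preds w = {v \<in> L. (v, w) \<in> lenlex r}"

lemma finite_short: "finite {v \<in> L. length v \<le> k}"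
proof -
  have "finite A" using ans by (simp add: abstract_numeration_system_def)
  then have "finite {v. set v \<subseteq> A \<and> length v \<le> k}" by (rule finite_lists_length_le)
  then show ?thesis
    by (rule rev_finite_subset) (use words in \<open>auto simp: in_lists_conv_set\<close>)
qed

lemma finite_preds: "finite (preds w)"
  by (rule finite_subset[OF _ finite_short[of "length w"]])
    (auto simp: preds_def lenlex_conv)

lemma card_preds_less: "v \<in> L \<Longrightarrow> (v, w) \<in> lenlex r \<Longrightarrow> card (preds v) < card (preds w)"
proof (rule psubset_card_mono[OF finite_preds])
  assume "v \<in> L" "(v, w) \<in> lenlex r"
  then show "preds v \<subset> preds w"
    using genealogical_irrefl[of v] transD[OF genealogical_trans, of _ v w]
    unfolding preds_def by blast
qed

lemma bij_card_preds: "bij_betw (\<lambda>w. card (preds w)) L UNIV"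
proof -
  let ?c = "\<lambda>w. card (preds w)"
  have inj: "inj_on ?c L"
  proof (rule inj_onI, rule ccontr)
    fix v w assume "v \<in> L" "w \<in> L" "?c v = ?c w" "v \<noteq> w"
    then show False
      using genealogical_total[of v w] card_preds_less[of v w] card_preds_less[of w v] by auto
  qed
  have down: "\<exists>v \<in> L. ?c v = m" if w: "w \<in> L" "m < ?c w" for w m
  proof -
    have "?c ` preds w \<subseteq> {..<?c w}"
      using card_preds_less by (auto simp: preds_def)
    moreover have "card (?c ` preds w) = ?c w"
      by (rule card_image) (rule inj_on_subset[OF inj], auto simp: preds_def)
    ultimately have "?c ` preds w = {..<?c w}"
      by (simp add: card_subset_eq)
    then have "m \<in> ?c ` preds w"
      using w by simp
    then show ?thesis
      by (auto simp: preds_def)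
  qed
  have "infinite (?c ` L)"
    using inj ans by (simp add: finite_image_iff abstract_numeration_system_def)
  then have "\<exists>w \<in> L. m < ?c w" for m
    using finite_nat_set_iff_bounded_le[of "?c ` L"] not_le by blast
  then have "m \<in> ?c ` L" for m
    using down[of _ m] by (metis image_eqI)
  then have "?c ` L = UNIV"
    by blast
  with inj show ?thesis
    by (simp add: bij_betw_def)
qed

lemma rep_in: "rep L r n \<in> L" and card_preds_rep: "card (preds (rep L r n)) = n"
proof -
  have "n \<in> (\<lambda>w. card (preds w)) ` L"
    using bij_card_preds by (simp add: bij_betw_def)
  then obtain w where w: "w \<in> L" "card (preds w) = n"
    by blast
  have "v = w" if "v \<in> L" "card (preds v) = n" for v
    by (rule inj_onD[OF bij_betw_imp_inj_on[OF bij_card_preds]]) (use that w in simp_all)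
  with w have "\<exists>!w. w \<in> L \<and> card (preds w) = n"
    by blast
  then have "rep L r n \<in> L \<and> card (preds (rep L r n)) = n"
    unfolding rep_def preds_def by (rule theI')
  then show "rep L r n \<in> L" "card (preds (rep L r n)) = n" by auto
qed

lemma bij_rep: "bij_betw (rep L r) UNIV L"
proof -
  have "rep L r (card (preds w)) = w" if "w \<in> L" for w
    by (rule inj_onD[OF bij_betw_imp_inj_on[OF bij_card_preds]])
      (use that in \<open>simp_all add: rep_in card_preds_rep\<close>)
  then show ?thesis
    by (intro bij_betw_byWitness[where f' = "\<lambda>w. card (preds w)"])
      (auto simp: rep_in card_preds_rep)
qed

lemma rep_mono: "m < n \<Longrightarrow> (rep L r m, rep L r n) \<in> lenlex r"
  using genealogical_total[OF rep_in[of m] rep_in[of n]] card_preds_less[OF rep_in, of n "rep L r m"]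
  by (metis card_preds_rep less_asym less_irrefl)

lemma val_rep: "val L r (rep L r n) = n"
  unfolding val_def using bij_rep by (simp add: bij_betw_def the_inv_f_f)

lemma rep_val: "w \<in> L \<Longrightarrow> rep L r (val L r w) = w"
  using bij_rep val_rep by (metis bij_betw_imp_surj_on imageE)

lemma padded_val_replicate: "padded_val L r (replicate n None @ map Some w) = val L r w"
proof -
  have "dropWhile (\<lambda>a. a = None) (replicate n None @ map Some w) = map Some w"
    by (cases w) (simp_all add: dropWhile_append)
  then show ?thesis
    by (simp add: padded_val_def comp_def)
qed

end

end

theory Submission
  imports Defs
begin

text \<open>Take the product of an automaton for the graph of addition with two copies of an
  automaton for \<open>x\<close>, the copies reading the first and the third component of a triple and
  ignoring the padding. Projecting to the second component and determinizing yields an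
  automaton that, on \<open>rep n\<close>, knows all pairs of states reached by
  \<open>rep i\<close> and \<open>rep (i + n)\<close>. As \<open>rep n\<close> may have to be padded, the initial state
  collects everything reachable while the second component reads only the padding symbol.\<close>

lemma reached_in_states:
  assumes "deterministic_automaton A M" "w \<in> lists A"
  shows "reached M w \<in> states M"
  using assms(2)
  by (induction w rule: rev_induct)
    (use assms(1) in \<open>auto simp: reached_def deterministic_automaton_def\<close>)

text \<open>\<open>automatic_on\<close> asks for states of type \<open>nat\<close>, whereas a subset
  construction has sets as states. Transport along an injection \<open>h\<close> bridges the gap.
  Outputs are compared on words over \<open>A\<close> only: these keep \<open>M\<close> inside
  \<open>states M\<close>, where \<open>g\<close> inverts \<open>h\<close>.\<close>

lemma dfao_rename_states:
  fixes M :: "('q, 'a, 'o) dfao"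
  assumes "is_dfao A \<Delta> M"
  shows "\<exists>M' :: (nat, 'a, 'o) dfao. is_dfao A \<Delta> M' \<and>
           (\<forall>w \<in> lists A. dfao_output M' w = dfao_output M w)"
proof -
  have det: "deterministic_automaton A M"
    using assms by (simp add: is_dfao_def)
  then have "finite (states M)"
    by (simp add: deterministic_automaton_def)
  then obtain h :: "'q \<Rightarrow> nat" where h: "inj_on h (states M)"
    using finite_imp_inj_to_nat_seg by blast
  define g where "g = inv_into (states M) h"
  have g [simp]: "g (h q) = q" if "q \<in> states M" for q
    using h that by (simp add: g_def)
  define M' :: "(nat, 'a, 'o) dfao" where
    "M' = \<lparr>states = h ` states M, initial = h (initial M),
           trans_fun = (\<lambda>q a. h (trans_fun M (g q) a)), output_map = output_map M \<circ> g\<rparr>"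
  have "is_dfao A \<Delta> M'"
    using assms by (auto simp: is_dfao_def deterministic_automaton_def M'_def)
  moreover have "reached M' w = h (reached M w)" if "w \<in> lists A" for w
    using that
  proof (induction w rule: rev_induct)
    case (snoc a w)
    then have "reached M w \<in> states M"
      using reached_in_states[OF det] by simp
    with snoc show ?case
      by (simp add: reached_def M'_def)
  qed (simp add: reached_def M'_def)
  then have "dfao_output M' w = dfao_output M w" if "w \<in> lists A" for w
    using that reached_in_states[OF det] by (simp add: dfao_output_def M'_def)
  ultimately show ?thesis
    by blast
qed

text \<open>In the application \<open>\<pi>\<close> selects the middle track of a triple. The other
  tracks may be longer than \<open>w\<close>, hence the arbitrary amount \<open>j\<close> of
  padding.\<close>

definition states_over ::
    "'s set \<Rightarrow> ('q, 's, 'm) automaton_scheme \<Rightarrow> ('s \<Rightarrow> 'a option) \<Rightarrow> 'a list \<Rightarrow> 'q set" where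
  "states_over \<Sigma> M \<pi> w =
     {reached M z | z. z \<in> lists \<Sigma> \<and> (\<exists>j. map \<pi> z = replicate j None @ map Some w)}"

text \<open>Padding stands only to the left, so the last letter of a word lying above
  \<open>w @ [a]\<close> projects to \<open>Some a\<close>, and what precedes it lies above
  \<open>w\<close>. Hence the new set depends only on the old one and on \<open>a\<close>, as a
  subset construction requires.\<close>

lemma states_over_snoc:
  "states_over \<Sigma> M \<pi> (w @ [a]) =
     {trans_fun M q s | q s. q \<in> states_over \<Sigma> M \<pi> w \<and> s \<in> \<Sigma> \<and> \<pi> s = Some a}" (is "?L = ?R")
proof
  show "?L \<subseteq> ?R"
  proof
    fix p assume "p \<in> ?L"
    then obtain z j where z: "p = reached M z" "z \<in> lists \<Sigma>"
        "map \<pi> z = (replicate j None @ map Some w) @ [Some a]"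
      by (auto simp: states_over_def)
    \<comment> \<open>With \<open>append_assoc\<close> off, both sides end in a visible singleton
      and can be compared there.\<close>
    then obtain z' s where "z = z' @ [s]" "map \<pi> z' = replicate j None @ map Some w" "\<pi> s = Some a"
      by (cases z rule: rev_cases) (simp_all del: append_assoc)
    with z have "p = trans_fun M (reached M z') s" "reached M z' \<in> states_over \<Sigma> M \<pi> w"
        "s \<in> \<Sigma>" "\<pi> s = Some a"
      by (auto simp: states_over_def reached_def)
    then show "p \<in> ?R"
      by blast
  qed
  show "?R \<subseteq> ?L"
  proof
    fix p assume "p \<in> ?R"
    then obtain z j s where "p = trans_fun M (reached M z) s" "s \<in> \<Sigma>" "\<pi> s = Some a"
        "z \<in> lists \<Sigma>" "map \<pi> z = replicate j None @ map Some w"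
      by (auto simp: states_over_def)
    then have "p = reached M (z @ [s])" "z @ [s] \<in> lists \<Sigma>"
        "map \<pi> (z @ [s]) = replicate j None @ map Some (w @ [a])"
      by (simp_all add: reached_def)
    then show "p \<in> ?L"
      unfolding states_over_def by blast
  qed
qed

text \<open>An arbitrary \<open>f\<close> can serve as output map: \<open>states M\<close> has
  finitely many subsets, so the output alphabet is finite.\<close>

lemma states_over_dfao:
  fixes M :: "('q, 's, 'm) automaton_scheme" and f :: "'q set \<Rightarrow> 'o"
  assumes "deterministic_automaton \<Sigma> M" "finite A"
  shows "\<exists>(N :: (nat, 'a, 'o) dfao) \<Delta>. is_dfao A \<Delta> N \<and>
           (\<forall>w \<in> lists A. dfao_output N w = f (states_over \<Sigma> M \<pi> w))"
proof -
  define N :: "('q set, 'a, 'o) dfao" where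
    "N = \<lparr>states = Pow (states M), initial = states_over \<Sigma> M \<pi> [],
          trans_fun = (\<lambda>Q a. {trans_fun M q s | q s. q \<in> Q \<and> s \<in> \<Sigma> \<and> \<pi> s = Some a}),
          output_map = f\<rparr>"
  have "states_over \<Sigma> M \<pi> [] \<subseteq> states M"
    using reached_in_states[OF assms(1)] by (auto simp: states_over_def)
  then have "is_dfao A (f ` Pow (states M)) N"
    using assms by (auto simp: is_dfao_def deterministic_automaton_def N_def)
  moreover have "reached N w = states_over \<Sigma> M \<pi> w" for w
  proof (induction w rule: rev_induct)
    case (snoc a w)
    then show ?case
      by (simp add: states_over_snoc) (simp add: reached_def N_def)
  qed (simp add: reached_def N_def)
  then have "dfao_output N w = f (states_over \<Sigma> M \<pi> w)" for w
    by (simp add: dfao_output_def N_def)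
  ultimately show ?thesis
    using dfao_rename_states[of A "f ` Pow (states M)" N] by metis
qed

definition skip_padding :: "('q \<Rightarrow> 'a \<Rightarrow> 'q) \<Rightarrow> 'q \<Rightarrow> 'a option \<Rightarrow> 'q" where
  "skip_padding \<delta> q c = (case c of None \<Rightarrow> q | Some a \<Rightarrow> \<delta> q a)"

lemma foldl_skip_padding:
  "foldl (skip_padding \<delta>) q (replicate j None @ map Some w) = foldl \<delta> q w"
proof -
  have "foldl (skip_padding \<delta>) q (replicate j None) = q"
    by (induction j) (simp_all add: skip_padding_def)
  moreover have "foldl (skip_padding \<delta>) p (map Some w) = foldl \<delta> p w" for p
    by (induction w arbitrary: p) (simp_all add: skip_padding_def)
  ultimately show ?thesis
    by simp
qed

text \<open>The state of \<open>P\<close> stays visible as first component, so that acceptance by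
  \<open>P\<close> can still be tested in the output after determinization.\<close>

definition track_outer ::
    "('p, 'a option \<times> 'a option \<times> 'a option, 'm) automaton_scheme \<Rightarrow>
     ('q, 'a, 'n) automaton_scheme \<Rightarrow>
     ('p \<times> 'q \<times> 'q, 'a option \<times> 'a option \<times> 'a option) automaton" where
  "track_outer P M =
     \<lparr>states = states P \<times> states M \<times> states M, initial = (initial P, initial M, initial M),
      trans_fun = (\<lambda>(p, q, q') (c, b, d). (trans_fun P p (c, b, d),
        skip_padding (trans_fun M) q c, skip_padding (trans_fun M) q' d))\<rparr>"

lemma reached_track_outer:
  "reached (track_outer P M) z =
     (reached P z, foldl (skip_padding (trans_fun M)) (initial M) (map fst z),
      foldl (skip_padding (trans_fun M)) (initial M) (map (snd \<circ> snd) z))"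
  by (induction z rule: rev_induct)
    (simp_all add: reached_def track_outer_def split: prod.splits)

lemma deterministic_track_outer:
  assumes "deterministic_automaton (padded_alphabet A \<times> padded_alphabet A \<times> padded_alphabet A) P"
    and "deterministic_automaton A M"
  shows "deterministic_automaton
    (padded_alphabet A \<times> padded_alphabet A \<times> padded_alphabet A) (track_outer P M)"
  using assms
  by (auto simp: deterministic_automaton_def track_outer_def padded_alphabet_def
      skip_padding_def split: option.splits)

text \<open>Pad the three representations to the length of the longest. That one receives no
  padding, so the first letter is not the all-padding triple.\<close>

lemma (in ans_words) addition_graph_rep:
  "\<exists>z \<in> addition_graph L r. \<exists>j k l.
     map fst z = replicate j None @ map Some (rep L r i) \<and>
     map (fst \<circ> snd) z = replicate k None @ map Some (rep L r n) \<and>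
     map (snd \<circ> snd) z = replicate l None @ map Some (rep L r (i + n))"
proof -
  define K where "K = Max {length (rep L r m) | m. m \<in> {i, n, i + n}}"
  define pad where "pad m = replicate (K - length (rep L r m)) None @ map Some (rep L r m)" for m
  have set_eq: "{length (rep L r m) | m. m \<in> {i, n, i + n}} =
      {length (rep L r i), length (rep L r n), length (rep L r (i + n))}"
    by auto
  have len: "length (pad i) = K" "length (pad n) = K" "length (pad (i + n)) = K"
    unfolding K_def set_eq pad_def by auto
  have "K \<in> {length (rep L r i), length (rep L r n), length (rep L r (i + n))}"
    unfolding K_def set_eq by (intro Max_in) auto
  then obtain m where m: "m \<in> {i, n, i + n}" "K = length (rep L r m)"
    by blast
  \<comment> \<open>For \<open>K = 0\<close> all three words are empty and the condition on the
    first letter is void.\<close>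
  have "hd (pad m) \<noteq> None" if "K \<noteq> 0"
    using that m(2) by (cases "rep L r m") (simp_all add: pad_def)
  then have "pad i \<noteq> [] \<longrightarrow> (hd (pad i), hd (pad n), hd (pad (i + n))) \<noteq> (None, None, None)"
    using m(1) len by auto
  moreover have "pad m \<in> padded_language L" for m
    unfolding padded_language_def pad_def using rep_in by blast
  moreover have "padded_val L r (pad m) = m" for m
    by (simp add: pad_def padded_val_replicate val_rep)
  ultimately have "zip (pad i) (zip (pad n) (pad (i + n))) \<in> addition_graph L r"
    unfolding addition_graph_def mem_Collect_eq using len by metis
  moreover have "map fst (zip (pad i) (zip (pad n) (pad (i + n)))) = pad i"
    "map (fst \<circ> snd) (zip (pad i) (zip (pad n) (pad (i + n)))) = pad n"
    "map (snd \<circ> snd) (zip (pad i) (zip (pad n) (pad (i + n)))) = pad (i + n)"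
    using len by (simp_all flip: map_map)
  ultimately show ?thesis
    unfolding pad_def by blast
qed

text \<open>Stripped of padding, the outer tracks are words of \<open>L\<close>, hence
  representations, and the middle track forces their values to differ by \<open>n\<close>. So no
  spurious pair of positions can arise.\<close>

lemma (in ans_words) addition_graphD:
  assumes "z \<in> addition_graph L r"
    and mid: "map (fst \<circ> snd) z = replicate k None @ map Some (rep L r n)"
  obtains i j l where "map fst z = replicate j None @ map Some (rep L r i)"
    and "map (snd \<circ> snd) z = replicate l None @ map Some (rep L r (i + n))"
proof -
  from assms(1) obtain u v w where z: "z = zip u (zip v w)"
      and len: "length u = length v" "length v = length w"
      and pad: "u \<in> padded_language L" "w \<in> padded_language L"
      and sum: "padded_val L r u + padded_val L r v = padded_val L r w"
    unfolding addition_graph_def by blast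
  have proj: "map fst z = u" "map (fst \<circ> snd) z = v" "map (snd \<circ> snd) z = w"
    using len by (simp_all add: z flip: map_map)
  from pad obtain j u' l w' where u: "u = replicate j None @ map Some u'" "u' \<in> L"
      and w: "w = replicate l None @ map Some w'" "w' \<in> L"
    unfolding padded_language_def by blast
  \<comment> \<open>By \<open>mid\<close>, the word \<open>v\<close> has value \<open>n\<close>
    whatever its padding.\<close>
  have "val L r u' + n = val L r w'"
    using sum mid proj u w by (simp add: padded_val_replicate val_rep)
  then have "rep L r (val L r u' + n) = w'"
    using w by (simp add: rep_val)
  then show thesis
    using that[of j "val L r u'" l] proj u w by (simp add: rep_val)
qed

theorem theorem3p1:
  fixes L :: "'a list set" and A :: "'a set" and r :: "'a rel"
    and B :: "'b set" and x :: "nat \<Rightarrow> 'b"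
  assumes "abstract_numeration_system L A r"
    and "addable L A r"
    and "finite B"
    and "range x \<subseteq> B"
    and "automatic_on UNIV L A r x"
  shows "automatic_on {1..} L A r (boundary B x)"
proof -
  interpret ans_words L A r
    by unfold_locales (fact assms(1))
  let ?\<Sigma> = "padded_alphabet A \<times> padded_alphabet A \<times> padded_alphabet A"
  obtain P :: "(nat, 'a option \<times> 'a option \<times> 'a option) dfa"
    where P: "is_dfa ?\<Sigma> P" "addition_graph L r = dfa_language ?\<Sigma> P"
    using assms(2) unfolding addable_def regular_language_def by blast
  obtain M :: "(nat, 'a, 'b) dfao" and \<Delta>
    where M: "is_dfao A \<Delta> M" and x: "\<And>n. x n = dfao_output M (rep L r n)"
    using assms(5) unfolding automatic_on_def by blast
  let ?T = "track_outer P M"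
  let ?over = "states_over ?\<Sigma> ?T (fst \<circ> snd)"
  \<comment> \<open>\<open>states_over\<close> also collects states reached by words outside the
    graph of addition; the filter \<open>p \<in> finals P\<close> discards them.\<close>
  define f where "f Q = {(output_map M q, output_map M q') | p q q'. (p, q, q') \<in> Q \<and> p \<in> finals P}"
    for Q
  have "deterministic_automaton ?\<Sigma> ?T"
    using P M by (intro deterministic_track_outer) (simp_all add: is_dfa_def is_dfao_def)
  moreover have "finite A"
    using ans by (simp add: abstract_numeration_system_def)
  ultimately obtain N :: "(nat, 'a, ('b \<times> 'b) set) dfao" and \<Delta>'
    where N: "is_dfao A \<Delta>' N" "\<And>w. w \<in> lists A \<Longrightarrow> dfao_output N w = f (?over w)"
    using states_over_dfao[of ?\<Sigma> ?T A f "fst \<circ> snd"] by blast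
  \<comment> \<open>Since padding is skipped, the copies of \<open>M\<close> end where
    \<open>M\<close> ends on the unpadded words, so their outputs are \<open>x i\<close> and
    \<open>x m\<close>.\<close>
  have T: "reached ?T z = (reached P z, reached M (rep L r i), reached M (rep L r m))"
    if "map fst z = replicate j None @ map Some (rep L r i)"
      "map (snd \<circ> snd) z = replicate l None @ map Some (rep L r m)" for z i j m l
    using that unfolding reached_track_outer by (simp only: foldl_skip_padding reached_def)
  have "f (?over (rep L r n)) = {(x i, x (i + n)) | i. True}" for n
  proof
    \<comment> \<open>A final first component puts the word read into the graph of addition, and
      \<open>addition_graphD\<close> then identifies its outer tracks.\<close>
    show "f (?over (rep L r n)) \<subseteq> {(x i, x (i + n)) | i. True}"
    proof
      fix e assume "e \<in> f (?over (rep L r n))"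
      then obtain p q q' where e: "e = (output_map M q, output_map M q')"
          and Q: "(p, q, q') \<in> ?over (rep L r n)" and p: "p \<in> finals P"
        unfolding f_def by blast
      from Q obtain z k where z: "reached ?T z = (p, q, q')" "z \<in> lists ?\<Sigma>"
          "map (fst \<circ> snd) z = replicate k None @ map Some (rep L r n)"
        unfolding states_over_def mem_Collect_eq by metis
      then have "reached P z = p"
        by (simp add: reached_track_outer)
      then have "z \<in> addition_graph L r"
        using z p by (simp add: P dfa_language_def)
      then obtain i j l where "map fst z = replicate j None @ map Some (rep L r i)"
          "map (snd \<circ> snd) z = replicate l None @ map Some (rep L r (i + n))"
        using addition_graphD z(3) by blast
      from T[OF this] z(1) e have "e = (x i, x (i + n))"
        by (simp add: x dfao_output_def)
      then show "e \<in> {(x i, x (i + n)) | i. True}"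
        by blast
    qed
    \<comment> \<open>Every \<open>i\<close> contributes, by way of the padded triple for
      \<open>i\<close>, \<open>n\<close> and \<open>i + n\<close>.\<close>
    show "{(x i, x (i + n)) | i. True} \<subseteq> f (?over (rep L r n))"
    proof clarify
      fix i
      obtain z j k l where z: "z \<in> addition_graph L r"
          "map fst z = replicate j None @ map Some (rep L r i)"
          "map (fst \<circ> snd) z = replicate k None @ map Some (rep L r n)"
          "map (snd \<circ> snd) z = replicate l None @ map Some (rep L r (i + n))"
        using addition_graph_rep by blast
      have acc: "z \<in> lists ?\<Sigma>" "reached P z \<in> finals P"
        using z(1) by (simp_all add: P dfa_language_def)
      then have "reached ?T z \<in> ?over (rep L r n)"
        using z(3) unfolding states_over_def by blast
      then show "(x i, x (i + n)) \<in> f (?over (rep L r n))"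
        unfolding T[OF z(2,4)] f_def x dfao_output_def using acc by blast
    qed
  qed
  \<comment> \<open>Here \<open>n \<ge> 1\<close> enters through \<open>boundary_eq\<close>: the
    block between the two letters has length \<open>n - 1\<close>, a truncated subtraction.\<close>
  then have "boundary B x n = dfao_output N (rep L r n)" if "n \<in> {1..}" for n
    using that boundary_eq[OF assms(4)] N(2) rep_in words by (simp add: subset_iff)
  with N(1) show ?thesis
    unfolding automatic_on_def by blast
qed

end
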